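(* Let $\mathcal D_n=(\phi_\omega^n:\omega\in\Omega_n)$ be a frame of $\mathbb R^{I_n}$ with normalized elements, lower frame bound $a_n$ and analysis operator $\boldsymbol\Phi_n$. Let $V_n=u_n+\epsilon_n$ with $u_n\in\mathbb R^{I_n}$ and $\epsilon_n$ a random vector with independent $N(0,\sigma^2)$-distributed entries. Let $\alpha_n\in(0,1)$ and let $\hat u_n=\boldsymbol\Phi_n^+\,\mathbf S(\boldsymbol\Phi_nV_n,T)$ denote the soft-thresholding estimator with the extreme value threshold $$T=T(\alpha_n,|\Omega_n|):=\sigma\sqrt{2\log|\Omega_n|}+\sigma\,\frac{2z(\alpha_n)-\log\log|\Omega_n|-\log\pi}{2\sqrt{2\log|\Omega_n|}},\qquad z(\alpha_n):=-\log\log\big(1/(1-\alpha_n)\big),$$ and assume $0<T(\alpha_n,|\Omega_n|)\le\sigma\sqrt{2\log|\Omega_n|}$. Then $$\mathbf E\big(\|u_n-\hat u_n\|^2\big)\le\frac{\sigma^2}{a_n}\left(\log\big(1/(1-\alpha_n)\big)\sqrt{\pi\log|\Omega_n|}+(1+2\log|\Omega_n|)\sum_{\omega\in\Omega_n}\min\left\{1,\frac{|\langle\phi_\omega^n,u_n\rangle|^2}{\sigma^2}\right\}\right).$$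
   Context: Fix $d,n\in\mathbb N$ and $\sigma>0$; $I_n=\{0,\dots,n-1\}^d$, and $\mathbb R^{I_n}$ carries the Euclidean inner product $\langle\cdot,\cdot\rangle$ and norm $\|\cdot\|$. $\mathcal D_n$ ($\Omega_n$ finite) is a frame if there are $0<a_n\le b_n<\infty$ with $a_n\|u\|^2\le\sum_\omega|\langle\phi_\omega^n,u\rangle|^2\le b_n\|u\|^2$ for all $u\in\mathbb R^{I_n}$; the lower frame bound $a_n$ is the largest such constant. Normalized means $\|\phi_\omega^n\|=1$ for all $\omega$. The analysis operator is $(\boldsymbol\Phi_nu)(\omega)=\langle\phi_\omega^n,u\rangle$, with pseudoinverse $\boldsymbol\Phi_n^+=(\boldsymbol\Phi_n^*\boldsymbol\Phi_n)^{-1}\boldsymbol\Phi_n^*$. Soft-thresholding acts componentwise: $\mathbf S(Y,T)(\omega)=\operatorname{sign}(Y(\omega))(|Y(\omega)|-T)_+$. It is understood that $|\Omega_n|\ge2$, so that the threshold is defined. *)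

theory Defs
  imports "HOL-Probability.Probability"
begin

text \<open>
  The signal space over the grid \<open>{0,...,n-1}^d\<close> is rendered as \<^typ>\<open>real ^ ('n ^ 'd)\<close> with
  \<open>n = CARD('n)\<close> and \<open>d = CARD('d)\<close>: a grid point is a \<open>d\<close>-tuple over an \<open>n\<close>-element type.
  A dictionary is a family indexed by a finite type \<^typ>\<open>'w\<close>.
\<close>

definition frame_bounds :: "('w::finite \<Rightarrow> 'a::real_inner) \<Rightarrow> real \<Rightarrow> real \<Rightarrow> bool" where
  "frame_bounds \<phi> a b \<longleftrightarrow> 0 < a \<and> a \<le> b \<and>
     (\<forall>u. a * (norm u)\<^sup>2 \<le> (\<Sum>\<omega>\<in>UNIV. \<bar>\<phi> \<omega> \<bullet> u\<bar>\<^sup>2) \<and>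
          (\<Sum>\<omega>\<in>UNIV. \<bar>\<phi> \<omega> \<bullet> u\<bar>\<^sup>2) \<le> b * (norm u)\<^sup>2)"

definition is_frame :: "('w::finite \<Rightarrow> 'a::real_inner) \<Rightarrow> bool" where
  "is_frame \<phi> \<longleftrightarrow> (\<exists>a b. frame_bounds \<phi> a b)"

text \<open>The maximum exists whenever \<open>\<phi>\<close> is a frame of a nonzero space.\<close>

definition lower_frame_bound :: "('w::finite \<Rightarrow> 'a::real_inner) \<Rightarrow> real" where
  "lower_frame_bound \<phi> = (GREATEST a. \<exists>b. frame_bounds \<phi> a b)"

definition analysis_operator :: "('w::finite \<Rightarrow> 'a::real_inner) \<Rightarrow> 'a \<Rightarrow> real ^ 'w" where
  "analysis_operator \<phi> u = (\<chi> \<omega>. \<phi> \<omega> \<bullet> u)"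

text \<open>
  The pseudoinverse of an injective linear map; for such \<open>F\<close> the composition with its
  adjoint is bijective, so \<^const>\<open>inv\<close> is its genuine inverse.
\<close>

definition pseudoinverse ::
    "('a::euclidean_space \<Rightarrow> 'b::euclidean_space) \<Rightarrow> 'b \<Rightarrow> 'a" where
  "pseudoinverse F = inv (adjoint F \<circ> F) \<circ> adjoint F"

definition soft_threshold :: "real ^ 'w \<Rightarrow> real \<Rightarrow> real ^ 'w" where
  "soft_threshold Y T = (\<chi> \<omega>. sgn (Y $ \<omega>) * max 0 (\<bar>Y $ \<omega>\<bar> - T))"

definition soft_threshold_estimator ::
    "('w::finite \<Rightarrow> 'a::euclidean_space) \<Rightarrow> real \<Rightarrow> 'a \<Rightarrow> 'a" where
  "soft_threshold_estimator \<phi> T v =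
     pseudoinverse (analysis_operator \<phi>) (soft_threshold (analysis_operator \<phi> v) T)"

definition gumbel_quantile :: "real \<Rightarrow> real" where
  "gumbel_quantile \<alpha> = - ln (ln (1 / (1 - \<alpha>)))"

definition extreme_value_threshold :: "real \<Rightarrow> real \<Rightarrow> nat \<Rightarrow> real" where
  "extreme_value_threshold \<sigma> \<alpha> m =
     \<sigma> * sqrt (2 * ln (real m)) +
     \<sigma> * ((2 * gumbel_quantile \<alpha> - ln (ln (real m)) - ln pi) / (2 * sqrt (2 * ln (real m))))"

end

theory Submission
  imports Defs
begin

text \<open>
  Because \<open>a * \<parallel>w\<parallel>\<^sup>2 \<le> \<parallel>\<Phi> w\<parallel>\<^sup>2\<close> and \<open>\<Phi> \<Phi>\<^sup>+\<close> is an orthogonal projection, the error is at most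
  \<open>1 / a\<close> times the sum of the squared errors of the thresholded coefficients, each of which is a
  scalar Gaussian problem: the noise coefficients are correlated, but each is \<open>N(0, \<sigma>\<^sup>2)\<close>.
  The scalar risk at mean \<open>\<mu>\<close> is at most \<open>\<sigma>\<^sup>2 + T\<^sup>2\<close> and also at most the risk at \<open>0\<close> plus \<open>\<mu>\<^sup>2\<close>.
  The risk at \<open>0\<close> is at most \<open>\<sigma>\<^sup>2 * exp (- T\<^sup>2 / (2 * \<sigma>\<^sup>2))\<close>, and the second summand of the threshold
  \<open>T\<close> is chosen such that the number \<open>m\<close> of frame elements times this exponential is at most
  \<open>ln (1 / (1 - \<alpha>)) * sqrt (pi * ln m)\<close>.
\<close>

section \<open>Pointwise inequalities for scalar soft-thresholding\<close>

abbreviation soft :: "real \<Rightarrow> real \<Rightarrow> real" where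
  "soft T y \<equiv> sgn y * max 0 (\<bar>y\<bar> - T)"

text \<open>In every range of \<open>e\<close> the error is bounded in absolute value by that of
  \<open>soft T e\<close> or that of \<open>\<mu>\<close>, so its square is at most one of the two
  squares and hence their sum. Soft-thresholding is odd, so reflecting mean and noise together
  reduces to a nonnegative mean.\<close>

lemma power2_soft_shift_le:
  assumes "0 \<le> T"
  shows "(soft T (\<mu> + e) - \<mu>)\<^sup>2 \<le> (soft T e)\<^sup>2 + \<mu>\<^sup>2"
proof -
  have *: "(soft T (\<mu> + e) - \<mu>)\<^sup>2 \<le> (soft T e)\<^sup>2 + \<mu>\<^sup>2" if "0 \<le> \<mu>" for \<mu> e :: real
  proof -
    consider "e > T" | "\<bar>e\<bar> \<le> T" | "e < - T" by linarith
    then show ?thesis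
    proof cases
      case 1
      then show ?thesis using assms that by (simp add: sgn_if max_def)
    next
      case 2
      then have "\<bar>soft T (\<mu> + e) - \<mu>\<bar> \<le> \<bar>\<mu>\<bar>"
        using assms that by (auto simp: sgn_if max_def)
      then show ?thesis using 2 abs_le_square_iff[of "soft T (\<mu> + e) - \<mu>" \<mu>] by simp
    next
      case 3
      then have e: "soft T e = e + T" using assms by (simp add: sgn_if max_def)
      consider "\<mu> + e < - T" | "\<bar>\<mu> + e\<bar> \<le> T" | "\<mu> + e > T" by linarith
      then show ?thesis
      proof cases
        case 1
        then have "soft T (\<mu> + e) - \<mu> = e + T" using assms by (simp add: sgn_if max_def)
        then have "(soft T (\<mu> + e) - \<mu>)\<^sup>2 = (soft T e)\<^sup>2" by (simp only: e)
        then show ?thesis by (simp only: le_add_same_cancel1 zero_le_power2)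
      next
        case 2
        then show ?thesis by (simp add: max_def)
      next
        case 3
        then have "soft T (\<mu> + e) - \<mu> = e - T" using assms by (simp add: sgn_if max_def)
        \<comment> \<open>The mean outweighs the strongly negative noise:
          \<open>\<mu> > T - e\<close>, and \<open>T - e\<close> is positive.\<close>
        moreover have "\<bar>e - T\<bar> \<le> \<bar>\<mu>\<bar>" using 3 \<open>e < - T\<close> assms that by linarith
        ultimately have "(soft T (\<mu> + e) - \<mu>)\<^sup>2 \<le> \<mu>\<^sup>2" by (simp only: abs_le_square_iff)
        then show ?thesis by (rule add_increasing[OF zero_le_power2])
      qed
    qed
  qed
  show ?thesis
  proof (cases "0 \<le> \<mu>")
    case True
    then show ?thesis by (rule *)
  next
    case False
    have odd: "soft T (- y) = - soft T y" for y by (simp add: sgn_minus)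
    have "(soft T (\<mu> + e) - \<mu>)\<^sup>2 = (soft T (- \<mu> + - e) - - \<mu>)\<^sup>2"
      using odd[of "\<mu> + e"] by (simp add: power2_commute)
    also have "\<dots> \<le> (soft T (- e))\<^sup>2 + (- \<mu>)\<^sup>2"
      by (rule *) (use False in simp)
    also have "\<dots> = (soft T e)\<^sup>2 + \<mu>\<^sup>2" by (simp only: odd power2_minus)
    finally show ?thesis .
  qed
qed

text \<open>
  The error is \<open>e - g (\<mu> + e)\<close> for the clipping function \<open>g\<close>, and monotonicity of \<open>g\<close> gives
  \<open>e * g (\<mu> + e) \<ge> e * g \<mu>\<close>.
\<close>

lemma power2_soft_shift_le_clip:
  assumes "0 \<le> T"
  shows "(soft T (\<mu> + e) - \<mu>)\<^sup>2 \<le> e\<^sup>2 - 2 * max (- T) (min T \<mu>) * e + T\<^sup>2"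
proof -
  define g where "g y = max (- T) (min T y)" for y
  have eq: "soft T (\<mu> + e) - \<mu> = e - g (\<mu> + e)"
    using assms by (auto simp: g_def sgn_if max_def min_def)
  have "e * (g (\<mu> + e) - g \<mu>) \<ge> 0"
    using assms by (cases "0 \<le> e") (auto simp: g_def intro!: mult_nonneg_nonneg mult_nonpos_nonpos)
  moreover have "\<bar>g (\<mu> + e)\<bar> \<le> \<bar>T\<bar>"
    using assms by (auto simp: g_def)
  then have "(g (\<mu> + e))\<^sup>2 \<le> T\<^sup>2"
    by (simp only: abs_le_square_iff)
  ultimately show ?thesis
    unfolding eq g_def[symmetric] by (simp add: power2_diff algebra_simps)
qed

section \<open>Gaussian risk of a single coefficient\<close>

lemma normal_density_shift_le:
  assumes "0 < \<sigma>" "0 \<le> x * T"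
  shows "normal_density 0 \<sigma> (x + T) \<le> exp (- T\<^sup>2 / (2 * \<sigma>\<^sup>2)) * normal_density 0 \<sigma> x"
proof -
  have "- (x + T)\<^sup>2 / (2 * \<sigma>\<^sup>2) \<le> - T\<^sup>2 / (2 * \<sigma>\<^sup>2) + - x\<^sup>2 / (2 * \<sigma>\<^sup>2)"
  proof -
    \<comment> \<open>This is the cross term of the expanded square in the exponent. It is
      nonnegative for a shift away from the origin, and dropping it leaves two exponents that
      factor.\<close>
    have "0 \<le> x * T / \<sigma>\<^sup>2" using assms by simp
    then show ?thesis using assms(1) by (simp add: power2_sum add_divide_distrib diff_divide_distrib)
  qed
  then have "exp (- (x + T)\<^sup>2 / (2 * \<sigma>\<^sup>2)) \<le> exp (- T\<^sup>2 / (2 * \<sigma>\<^sup>2)) * exp (- x\<^sup>2 / (2 * \<sigma>\<^sup>2))"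
    by (simp add: exp_add[symmetric])
  from mult_left_mono[OF this, of "1 / sqrt (2 * pi * \<sigma>\<^sup>2)"] show ?thesis
    by (simp add: normal_density_def)
qed

text \<open>
  Translating both tails by \<open>T\<close> to the origin turns the integrand into \<open>x\<^sup>2\<close> times a density
  shifted away from the origin.
\<close>

lemma nn_integral_soft_normal_le:
  assumes "0 < \<sigma>" "0 \<le> T"
  shows "(\<integral>\<^sup>+x. ennreal (normal_density 0 \<sigma> x) * ennreal ((soft T x)\<^sup>2) \<partial>lborel)
    \<le> ennreal (\<sigma>\<^sup>2 * exp (- T\<^sup>2 / (2 * \<sigma>\<^sup>2)))"
proof -
  let ?n = "normal_density 0 \<sigma>"
  define p where "p x = (if T < x then ?n x * (x - T)\<^sup>2 else 0)" for x
  define q where "q x = (if x < - T then ?n x * (x + T)\<^sup>2 else 0)" for x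
  have [measurable]: "p \<in> borel_measurable borel" "q \<in> borel_measurable borel"
    unfolding p_def[abs_def] q_def[abs_def] by measurable
  have nonneg: "0 \<le> p x" "0 \<le> q x" for x by (simp_all add: p_def q_def)
  have "ennreal (?n x) * ennreal ((soft T x)\<^sup>2) = ennreal (p x) + ennreal (q x)" for x
  proof -
    have "?n x * (soft T x)\<^sup>2 = p x + q x"
      using assms by (auto simp: p_def q_def sgn_if max_def power2_eq_square algebra_simps)
    then show ?thesis
      by (simp add: ennreal_mult'[symmetric] ennreal_plus[symmetric] nonneg del: ennreal_plus)
  qed
  then have "(\<integral>\<^sup>+x. ennreal (?n x) * ennreal ((soft T x)\<^sup>2) \<partial>lborel)
      = (\<integral>\<^sup>+x. ennreal (p x) \<partial>lborel) + (\<integral>\<^sup>+x. ennreal (q x) \<partial>lborel)"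
    by (simp add: nn_integral_add)
  also have "(\<integral>\<^sup>+x. ennreal (p x) \<partial>lborel) = (\<integral>\<^sup>+x. ennreal (p (x + T)) \<partial>lborel)"
    using nn_integral_real_affine[of "\<lambda>x. ennreal (p x)" 1 T] by (simp add: add.commute)
  also have "(\<integral>\<^sup>+x. ennreal (q x) \<partial>lborel) = (\<integral>\<^sup>+x. ennreal (q (x + - T)) \<partial>lborel)"
    using nn_integral_real_affine[of "\<lambda>x. ennreal (q x)" 1 "- T"] by (simp add: add.commute)
  also have "(\<integral>\<^sup>+x. ennreal (p (x + T)) \<partial>lborel) + (\<integral>\<^sup>+x. ennreal (q (x + - T)) \<partial>lborel)
      = (\<integral>\<^sup>+x. ennreal (p (x + T) + q (x + - T)) \<partial>lborel)"
    by (simp add: nn_integral_add nonneg)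
  \<comment> \<open>The translated tails live on \<open>0 < x\<close> and on \<open>x < 0\<close>,
    so one full second moment bounds their sum, with no factor of two.\<close>
  also have "\<dots> \<le> (\<integral>\<^sup>+x. ennreal (exp (- T\<^sup>2 / (2 * \<sigma>\<^sup>2)) * (?n x * x\<^sup>2)) \<partial>lborel)"
  proof (intro nn_integral_mono ennreal_leI)
    fix x :: real
    let ?c = "exp (- T\<^sup>2 / (2 * \<sigma>\<^sup>2))"
    show "p (x + T) + q (x + - T) \<le> ?c * (?n x * x\<^sup>2)"
    proof (cases "0 < x")
      case True
      then have "p (x + T) + q (x + - T) = ?n (x + T) * x\<^sup>2"
        using assms by (simp add: p_def q_def)
      also have "\<dots> \<le> (?c * ?n x) * x\<^sup>2"
        using normal_density_shift_le[of \<sigma> x T] assms True by (intro mult_right_mono) auto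
      finally show ?thesis by simp
    next
      case False
      then have "p (x + T) + q (x + - T) \<le> ?n (x + - T) * x\<^sup>2"
        using assms by (simp add: p_def q_def)
      also have "\<dots> \<le> (?c * ?n x) * x\<^sup>2"
        using normal_density_shift_le[of \<sigma> x "- T"] assms False
        by (intro mult_right_mono) (auto simp: mult_nonpos_nonneg)
      finally show ?thesis by simp
    qed
  qed
  also have "\<dots> = ennreal (\<integral>x. exp (- T\<^sup>2 / (2 * \<sigma>\<^sup>2)) * (?n x * x\<^sup>2) \<partial>lborel)"
    using integrable_normal_moment[OF assms(1), of 0 2]
    by (intro nn_integral_eq_integral) auto
  also have "(\<integral>x. exp (- T\<^sup>2 / (2 * \<sigma>\<^sup>2)) * (?n x * x\<^sup>2) \<partial>lborel) = exp (- T\<^sup>2 / (2 * \<sigma>\<^sup>2)) * \<sigma>\<^sup>2"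
    using integral_normal_moment_even[OF assms(1), of 0 1] by simp
  finally show ?thesis by (simp add: mult.commute)
qed

lemma (in prob_space) soft_threshold_risk_le:
  assumes X: "distributed M lborel X (normal_density 0 \<sigma>)" and "0 < \<sigma>" "0 \<le> T"
  shows "integrable M (\<lambda>x. (soft T (\<mu> + X x) - \<mu>)\<^sup>2)"
    and "expectation (\<lambda>x. (soft T (\<mu> + X x) - \<mu>)\<^sup>2)
      \<le> \<sigma>\<^sup>2 * exp (- T\<^sup>2 / (2 * \<sigma>\<^sup>2)) + (\<sigma>\<^sup>2 + T\<^sup>2) * min 1 (\<mu>\<^sup>2 / \<sigma>\<^sup>2)"
proof -
  have [measurable]: "X \<in> borel_measurable M"
    using distributed_measurable[OF X] by simp
  have i1: "integrable M X"
    using distributed_integrable[OF X, of "\<lambda>x. x"] integrable_normal_moment_nz_1[OF \<open>0 < \<sigma>\<close>, of 0]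
    by simp
  have e1: "expectation X = 0"
    using normal_distributed_expectation[OF assms(2) X] .
  have i2: "integrable M (\<lambda>x. (X x)\<^sup>2)"
    using distributed_integrable[OF X, of "\<lambda>x. x\<^sup>2"] integrable_normal_moment[OF \<open>0 < \<sigma>\<close>, of 0 2]
    by simp
  have e2: "expectation (\<lambda>x. (X x)\<^sup>2) = \<sigma>\<^sup>2"
    using normal_distributed_variance[OF \<open>0 < \<sigma>\<close> X] e1 by simp
  have is2: "integrable M (\<lambda>x. (soft T (X x))\<^sup>2)"
    by (rule Bochner_Integration.integrable_bound[OF i2])
       (use \<open>0 \<le> T\<close> in \<open>auto simp: abs_le_square_iff[symmetric] sgn_if max_def\<close>)
  have "ennreal (expectation (\<lambda>x. (soft T (X x))\<^sup>2)) = (\<integral>\<^sup>+x. ennreal ((soft T (X x))\<^sup>2) \<partial>M)"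
    by (rule nn_integral_eq_integral[symmetric, OF is2]) simp
  also have "\<dots> = (\<integral>\<^sup>+x. ennreal (normal_density 0 \<sigma> x) * ennreal ((soft T x)\<^sup>2) \<partial>lborel)"
    by (rule distributed_nn_integral[symmetric, OF X]) simp
  also have "\<dots> \<le> ennreal (\<sigma>\<^sup>2 * exp (- T\<^sup>2 / (2 * \<sigma>\<^sup>2)))"
    by (rule nn_integral_soft_normal_le[OF assms(2,3)])
  finally have es: "expectation (\<lambda>x. (soft T (X x))\<^sup>2) \<le> \<sigma>\<^sup>2 * exp (- T\<^sup>2 / (2 * \<sigma>\<^sup>2))"
    by simp
  show int: "integrable M (\<lambda>x. (soft T (\<mu> + X x) - \<mu>)\<^sup>2)"
  proof (rule Bochner_Integration.integrable_bound)
    show "integrable M (\<lambda>x. (soft T (X x))\<^sup>2 + \<mu>\<^sup>2)" using is2 by simp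
  qed (use power2_soft_shift_le[OF \<open>0 \<le> T\<close>] in auto)
  let ?E = "expectation (\<lambda>x. (soft T (\<mu> + X x) - \<mu>)\<^sup>2)"
  have "?E \<le> expectation (\<lambda>x. (soft T (X x))\<^sup>2 + \<mu>\<^sup>2)"
    using is2 by (intro integral_mono int power2_soft_shift_le[OF \<open>0 \<le> T\<close>]) auto
  also have "\<dots> = expectation (\<lambda>x. (soft T (X x))\<^sup>2) + \<mu>\<^sup>2"
    using is2 by (simp add: prob_space)
  finally have b1: "?E \<le> \<sigma>\<^sup>2 * exp (- T\<^sup>2 / (2 * \<sigma>\<^sup>2)) + \<mu>\<^sup>2"
    using es by simp
  let ?g = "max (- T) (min T \<mu>)"
  \<comment> \<open>The clipped mean \<open>?g\<close> is a constant, so the term linear in the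
    centred noise vanishes in expectation.\<close>
  have "?E \<le> expectation (\<lambda>x. (X x)\<^sup>2 - 2 * ?g * X x + T\<^sup>2)"
    using i1 i2 by (intro integral_mono int power2_soft_shift_le_clip[OF \<open>0 \<le> T\<close>]) auto
  also have "\<dots> = \<sigma>\<^sup>2 + T\<^sup>2"
    using i1 i2 by (simp add: e1 e2 prob_space)
  finally have b2: "?E \<le> \<sigma>\<^sup>2 + T\<^sup>2" .
  show "?E \<le> \<sigma>\<^sup>2 * exp (- T\<^sup>2 / (2 * \<sigma>\<^sup>2)) + (\<sigma>\<^sup>2 + T\<^sup>2) * min 1 (\<mu>\<^sup>2 / \<sigma>\<^sup>2)"
  proof (cases "\<mu>\<^sup>2 / \<sigma>\<^sup>2 \<le> 1")
    case True
    \<comment> \<open>For small means the factor \<open>\<sigma>\<^sup>2\<close> is enlarged to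
      \<open>\<sigma>\<^sup>2 + T\<^sup>2\<close>, so that both cases share one formula with the
      minimum.\<close>
    have "\<mu>\<^sup>2 = \<sigma>\<^sup>2 * (\<mu>\<^sup>2 / \<sigma>\<^sup>2)" using \<open>0 < \<sigma>\<close> by simp
    also have "\<dots> \<le> (\<sigma>\<^sup>2 + T\<^sup>2) * (\<mu>\<^sup>2 / \<sigma>\<^sup>2)" by (intro mult_right_mono) auto
    finally show ?thesis using b1 unfolding min_absorb2[OF True] by linarith
  next
    case False
    then have "min 1 (\<mu>\<^sup>2 / \<sigma>\<^sup>2) = 1" by simp
    then show ?thesis using b2 by (simp add: add_increasing)
  qed
qed

section \<open>Marginal law of a noise coefficient\<close>

lemma power2_norm_vec: "(norm (y :: real ^ 'w))\<^sup>2 = (\<Sum>i\<in>UNIV. (y $ i)\<^sup>2)"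
  unfolding power2_norm_eq_inner inner_vec_def by (simp add: power2_eq_square)

lemma (in prob_space) distributed_inner_normal:
  fixes \<epsilon> :: "'a \<Rightarrow> real ^ 'i" and v :: "real ^ 'i"
  assumes "0 < \<sigma>" "norm v = 1"
    and indep: "indep_vars (\<lambda>_. borel) (\<lambda>i x. \<epsilon> x $ i) UNIV"
    and dist: "\<And>i. distributed M lborel (\<lambda>x. \<epsilon> x $ i) (normal_density 0 \<sigma>)"
  shows "distributed M lborel (\<lambda>x. v \<bullet> \<epsilon> x) (normal_density 0 \<sigma>)"
proof -
  \<comment> \<open>A zero entry of \<open>v\<close> would contribute a degenerate normal law,
    whereas \<open>sum_indep_normal\<close> asks for positive standard deviations. The remaining
    index set is nonempty because \<open>v\<close> is a unit vector.\<close>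
  define I where "I = {i. v $ i \<noteq> 0}"
  have "I \<noteq> {}"
    using assms(2) by (auto simp: I_def vec_eq_iff[of v 0, simplified, symmetric])
  have ind: "indep_vars (\<lambda>_. borel) (\<lambda>i x. v $ i * \<epsilon> x $ i) I"
    using indep_vars_compose2[OF indep_vars_subset[OF indep, of I], of "\<lambda>i y. v $ i * y" "\<lambda>_. borel"]
    by simp
  have d: "distributed M lborel (\<lambda>x. v $ i * \<epsilon> x $ i) (normal_density 0 (\<bar>v $ i\<bar> * \<sigma>))" if "i \<in> I" for i
    using normal_density_affine[OF dist[of i] \<open>0 < \<sigma>\<close>, of "v $ i" 0] that by (simp add: I_def)
  have "distributed M lborel (\<lambda>x. \<Sum>i\<in>I. v $ i * \<epsilon> x $ i)
      (normal_density (\<Sum>i\<in>I. 0) (sqrt (\<Sum>i\<in>I. (\<bar>v $ i\<bar> * \<sigma>)\<^sup>2)))"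
    by (rule sum_indep_normal[OF _ \<open>I \<noteq> {}\<close> ind]) (use d \<open>0 < \<sigma>\<close> in \<open>auto simp: I_def\<close>)
  moreover have "(\<Sum>i\<in>I. (\<bar>v $ i\<bar> * \<sigma>)\<^sup>2) = \<sigma>\<^sup>2"
  proof -
    have "(\<Sum>i\<in>I. (\<bar>v $ i\<bar> * \<sigma>)\<^sup>2) = (\<Sum>i\<in>UNIV. (v $ i)\<^sup>2) * \<sigma>\<^sup>2"
      unfolding sum_distrib_right
      by (rule sum.mono_neutral_cong_left) (auto simp: I_def power_mult_distrib)
    also have "(\<Sum>i\<in>UNIV. (v $ i)\<^sup>2) = (norm v)\<^sup>2"
      by (rule power2_norm_vec[symmetric])
    finally show ?thesis by (simp add: assms(2))
  qed
  moreover have "(\<Sum>i\<in>I. v $ i * \<epsilon> x $ i) = v \<bullet> \<epsilon> x" for x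
    unfolding inner_vec_def by (rule sum.mono_neutral_cong_left) (auto simp: I_def)
  ultimately show ?thesis using \<open>0 < \<sigma>\<close> by simp
qed

section \<open>Frames, least squares and the error of the estimator\<close>

lemma linear_analysis_operator: "linear (analysis_operator \<phi>)"
  by (rule linearI) (simp_all add: analysis_operator_def vec_eq_iff inner_add_right)

text \<open>\<open>GREATEST\<close> carries information only if a maximum exists. The admissible
  lower bounds form a nonempty set, bounded above by testing a unit basis vector, and the frame
  inequality passes to their supremum, which is therefore attained.\<close>

lemma lower_frame_bound:
  fixes \<phi> :: "'w::finite \<Rightarrow> 'a::euclidean_space"
  assumes "is_frame \<phi>"
  shows "0 < lower_frame_bound \<phi>"
    and "lower_frame_bound \<phi> * (norm u)\<^sup>2 \<le> (norm (analysis_operator \<phi> u))\<^sup>2"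
proof -
  define N where "N u = (\<Sum>\<omega>\<in>UNIV. \<bar>\<phi> \<omega> \<bullet> u\<bar>\<^sup>2)" for u
  let ?A = "{a. \<exists>b. frame_bounds \<phi> a b}"
  obtain a0 b0 where ab0: "frame_bounds \<phi> a0 b0" using assms by (auto simp: is_frame_def)
  have bnd: "a * (norm u)\<^sup>2 \<le> N u" if "a \<in> ?A" for a u
    using that by (auto simp: frame_bounds_def N_def)
  obtain e :: 'a where e: "e \<in> Basis" using nonempty_Basis by blast
  have bdd: "bdd_above ?A"
    by (rule bdd_aboveI[of _ "N e"]) (use bnd[of _ e] e in simp)
  have ge: "a \<le> Sup ?A" if "a \<in> ?A" for a
    by (rule cSup_upper[OF that bdd])
  have sup: "Sup ?A * (norm u)\<^sup>2 \<le> N u" for u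
  proof (cases "u = 0")
    case False
    then have "Sup ?A \<le> N u / (norm u)\<^sup>2"
      using ab0 bnd by (intro cSup_least) (auto simp: field_simps)
    then show ?thesis using False by (simp add: field_simps)
  qed (simp add: N_def)
  have "0 < Sup ?A" 
  proof (rule less_le_trans[OF _ ge])
    show "0 < a0" using ab0 by (simp add: frame_bounds_def)
  qed (use ab0 in blast)
  \<comment> \<open>The upper bound is raised to the maximum so that the required order of the two
    bounds is immediate.\<close>
  have "frame_bounds \<phi> (Sup ?A) (max b0 (Sup ?A))"
    unfolding frame_bounds_def[of _ "Sup ?A"]
  proof (intro conjI allI)
    fix u
    show "Sup ?A * (norm u)\<^sup>2 \<le> (\<Sum>\<omega>\<in>UNIV. \<bar>\<phi> \<omega> \<bullet> u\<bar>\<^sup>2)" using sup[of u] by (simp add: N_def)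
    have "(\<Sum>\<omega>\<in>UNIV. \<bar>\<phi> \<omega> \<bullet> u\<bar>\<^sup>2) \<le> b0 * (norm u)\<^sup>2" using ab0 by (simp add: frame_bounds_def)
    also have "\<dots> \<le> max b0 (Sup ?A) * (norm u)\<^sup>2" by (intro mult_right_mono) auto
    finally show "(\<Sum>\<omega>\<in>UNIV. \<bar>\<phi> \<omega> \<bullet> u\<bar>\<^sup>2) \<le> max b0 (Sup ?A) * (norm u)\<^sup>2" .
  qed (use \<open>0 < Sup ?A\<close> in auto)
  then have eq: "lower_frame_bound \<phi> = Sup ?A"
    unfolding lower_frame_bound_def using ge by (intro Greatest_equality) blast+
  show "0 < lower_frame_bound \<phi>" using eq \<open>0 < Sup ?A\<close> by simp
  show "lower_frame_bound \<phi> * (norm u)\<^sup>2 \<le> (norm (analysis_operator \<phi> u))\<^sup>2"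
    using sup[of u] by (simp add: eq power2_norm_vec analysis_operator_def N_def)
qed

text \<open>Since \<open>x \<bullet> adjoint F (F x)\<close> is the squared norm of
  \<open>F x\<close>, injectivity of \<open>F\<close> passes to \<open>adjoint F \<circ> F\<close>,
  which is then bijective by finite dimension, so \<open>inv\<close> is a true inverse. The second
  claim is the normal equation of least squares: the residual is orthogonal to the range of
  \<open>F\<close>.\<close>

lemma
  fixes F :: "'a::euclidean_space \<Rightarrow> 'b::euclidean_space"
  assumes F: "linear F" and "inj F"
  shows linear_pseudoinverse: "linear (pseudoinverse F)"
    and adjoint_pseudoinverse: "adjoint F (F (pseudoinverse F y)) = adjoint F y"
proof -
  let ?G = "adjoint F \<circ> F"
  have G: "linear ?G" by (intro linear_compose F adjoint_linear)
  have "inj ?G"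
    unfolding linear_injective_0[OF G]
  proof (intro allI impI)
    fix x assume "?G x = 0"
    then have "x \<bullet> adjoint F (F x) = 0" by simp
    then have "F x = 0" by (simp add: adjoint_works[OF F])
    then show "x = 0" using linear_injective_0[OF F] \<open>inj F\<close> by blast
  qed
  then have "surj ?G" by (rule linear_inj_imp_surj[OF G])
  have "linear (inv ?G)"
    using G \<open>inj ?G\<close> \<open>surj ?G\<close> by (metis inj_linear_imp_inv_linear)
  then show "linear (pseudoinverse F)"
    unfolding pseudoinverse_def by (intro linear_compose adjoint_linear F)
  show "adjoint F (F (pseudoinverse F y)) = adjoint F y"
    using surj_f_inv_f[OF \<open>surj ?G\<close>, of "adjoint F y"] by (simp add: pseudoinverse_def)
qed

text \<open>By the normal equation, \<open>F w\<close> is the orthogonal projection of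
  \<open>y - F u\<close> onto the range of \<open>F\<close>; Cauchy-Schwarz then shows that
  projecting does not increase the norm.\<close>

lemma norm_pseudoinverse_error_le:
  fixes F :: "'a::euclidean_space \<Rightarrow> 'b::euclidean_space"
  assumes F: "linear F" and "inj F"
  shows "norm (F (pseudoinverse F y - u)) \<le> norm (y - F u)"
proof -
  define w where "w = pseudoinverse F y - u"
  have "F w \<bullet> F w = w \<bullet> adjoint F (F w)"
    by (simp add: adjoint_works[OF F])
  also have "adjoint F (F w) = adjoint F (y - F u)"
    by (simp add: w_def linear_diff[OF F] linear_diff[OF adjoint_linear[OF F]]
        adjoint_pseudoinverse[OF assms])
  also have "w \<bullet> adjoint F (y - F u) = F w \<bullet> (y - F u)"
    by (rule adjoint_works[OF F])
  also have "\<dots> \<le> norm (F w) * norm (y - F u)"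
    by (rule norm_cauchy_schwarz)
  finally have "norm (F w) * norm (F w) \<le> norm (F w) * norm (y - F u)"
    by (simp add: power2_norm_eq_inner[symmetric] power2_eq_square)
  then show ?thesis unfolding w_def[symmetric]
    by (cases "norm (F w) = 0") (auto simp: mult_le_cancel_left)
qed

lemma inj_analysis_operator:
  fixes \<phi> :: "'w::finite \<Rightarrow> 'a::euclidean_space"
  assumes "is_frame \<phi>"
  shows "inj (analysis_operator \<phi>)"
  unfolding linear_injective_0[OF linear_analysis_operator]
proof (intro allI impI)
  fix x assume "analysis_operator \<phi> x = 0"
  then show "x = 0"
    using lower_frame_bound(1)[OF assms] lower_frame_bound(2)[OF assms, of x] by (simp add: mult_le_0_iff)
qed

text \<open>This holds for each realisation \<open>v\<close>, so taking expectations afterwards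
  involves only the marginal law of each coefficient.\<close>

lemma soft_threshold_estimator_error_le:
  fixes \<phi> :: "'w::finite \<Rightarrow> 'a::euclidean_space"
  assumes "is_frame \<phi>"
  shows "(norm (u - soft_threshold_estimator \<phi> T v))\<^sup>2
    \<le> (\<Sum>\<omega>\<in>UNIV. (soft T (\<phi> \<omega> \<bullet> v) - \<phi> \<omega> \<bullet> u)\<^sup>2) / lower_frame_bound \<phi>"
proof -
  let ?F = "analysis_operator \<phi>" and ?a = "lower_frame_bound \<phi>"
  let ?y = "soft_threshold (?F v) T"
  have "?a * (norm (pseudoinverse ?F ?y - u))\<^sup>2 \<le> (norm (?F (pseudoinverse ?F ?y - u)))\<^sup>2"
    by (rule lower_frame_bound(2)[OF assms])
  also have "\<dots> \<le> (norm (?y - ?F u))\<^sup>2"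
    by (intro power_mono norm_pseudoinverse_error_le linear_analysis_operator
        inj_analysis_operator assms) simp
  also have "\<dots> = (\<Sum>\<omega>\<in>UNIV. (soft T (\<phi> \<omega> \<bullet> v) - \<phi> \<omega> \<bullet> u)\<^sup>2)"
    by (simp add: power2_norm_vec soft_threshold_def analysis_operator_def)
  finally show ?thesis
    using lower_frame_bound(1)[OF assms]
    by (simp add: soft_threshold_estimator_def field_simps norm_minus_commute)
qed

section \<open>Calibration of the extreme value threshold\<close>

lemma exp_extreme_value_threshold_le:
  assumes "0 < \<sigma>" "2 \<le> m" "0 < \<alpha>" "\<alpha> < 1"
  shows "real m * exp (- (extreme_value_threshold \<sigma> \<alpha> m)\<^sup>2 / (2 * \<sigma>\<^sup>2))
    \<le> ln (1 / (1 - \<alpha>)) * sqrt (pi * ln (real m))"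
proof -
  define L where "L = ln (real m)"
  define r where "r = sqrt (2 * L)"
  define c where "c = 2 * gumbel_quantile \<alpha> - ln L - ln pi"
  define l where "l = ln (1 / (1 - \<alpha>))"
  have "0 < L" using assms by (simp add: L_def)
  then have "0 < r" "r\<^sup>2 = 2 * L" by (simp_all add: r_def)
  have "0 < l" using assms unfolding l_def by (intro ln_gt_zero) (simp add: field_simps)
  have T: "extreme_value_threshold \<sigma> \<alpha> m = \<sigma> * (r + c / (2 * r))"
    by (simp add: extreme_value_threshold_def L_def r_def c_def algebra_simps)
  \<comment> \<open>The denominator \<open>2 * r\<close> makes the cross term exactly
    \<open>c\<close>; the last square is discarded.\<close>
  have "(r + c / (2 * r))\<^sup>2 = r\<^sup>2 + c + (c / (2 * r))\<^sup>2"
    using \<open>0 < r\<close> by (simp add: power2_sum)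
  also have "\<dots> \<ge> 2 * L + c" using \<open>r\<^sup>2 = 2 * L\<close> by simp
  finally have "- (extreme_value_threshold \<sigma> \<alpha> m)\<^sup>2 / (2 * \<sigma>\<^sup>2) \<le> - L - c / 2"
    using \<open>0 < \<sigma>\<close> by (simp add: T power_mult_distrib)
  then have "exp (- (extreme_value_threshold \<sigma> \<alpha> m)\<^sup>2 / (2 * \<sigma>\<^sup>2)) \<le> exp (- L - c / 2)"
    by simp
  \<comment> \<open>The correction \<open>c\<close> encodes the target: \<open>exp (- c / 2)\<close>
    equals \<open>l * sqrt (pi * L)\<close>, while \<open>exp (- L)\<close> cancels the number of
    frame elements.\<close>
  also have "- L - c / 2 = ln l + ln (sqrt (pi * L)) - L"
    using \<open>0 < L\<close> by (simp add: c_def gumbel_quantile_def l_def ln_sqrt ln_mult field_simps)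
  also have "exp \<dots> = l * sqrt (pi * L) / real m"
    using \<open>0 < L\<close> \<open>0 < l\<close> assms(2) by (simp add: exp_add exp_diff L_def[symmetric]) (simp add: L_def)
  finally show ?thesis using assms(2) by (simp add: l_def L_def field_simps)
qed

section \<open>Summation of the coefficient risks\<close>

theorem proposition3p10:
  fixes \<phi> :: "'w::finite \<Rightarrow> real ^ ('n::finite ^ 'd::finite)"
    and u :: "real ^ ('n ^ 'd)"
    and M :: "'s measure"
    and \<epsilon> :: "'s \<Rightarrow> real ^ ('n ^ 'd)"
    and \<sigma> \<alpha> T :: real
  assumes "0 < \<sigma>"
    and "CARD('w) \<ge> 2"
    and "is_frame \<phi>"
    and "\<And>\<omega>. norm (\<phi> \<omega>) = 1"
    and "prob_space M"
    and "prob_space.indep_vars M (\<lambda>_. borel) (\<lambda>i x. \<epsilon> x $ i) UNIV"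
    and "\<And>i. distributed M lborel (\<lambda>x. \<epsilon> x $ i) (\<lambda>t. ennreal (normal_density 0 \<sigma> t))"
    and "0 < \<alpha>" and "\<alpha> < 1"
    and "T = extreme_value_threshold \<sigma> \<alpha> CARD('w)"
    and "0 < T" and "T \<le> \<sigma> * sqrt (2 * ln (real CARD('w)))"
  shows "integrable M (\<lambda>x. (norm (u - soft_threshold_estimator \<phi> T (u + \<epsilon> x)))\<^sup>2) \<and>
    prob_space.expectation M (\<lambda>x. (norm (u - soft_threshold_estimator \<phi> T (u + \<epsilon> x)))\<^sup>2)
      \<le> \<sigma>\<^sup>2 / lower_frame_bound \<phi> *
        (ln (1 / (1 - \<alpha>)) * sqrt (pi * ln (real CARD('w))) +
         (1 + 2 * ln (real CARD('w))) * (\<Sum>\<omega>\<in>UNIV. min 1 (\<bar>\<phi> \<omega> \<bullet> u\<bar>\<^sup>2 / \<sigma>\<^sup>2)))"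
proof -
  interpret prob_space M by fact
  define L where "L = ln (real CARD('w))"
  let ?P = "pseudoinverse (analysis_operator \<phi>)" and ?a = "lower_frame_bound \<phi>"
  let ?risk = "\<lambda>\<omega> x. (soft T (\<phi> \<omega> \<bullet> u + \<phi> \<omega> \<bullet> \<epsilon> x) - \<phi> \<omega> \<bullet> u)\<^sup>2"
  let ?err = "\<lambda>x. (norm (u - soft_threshold_estimator \<phi> T (u + \<epsilon> x)))\<^sup>2"
  have a: "0 < ?a" using lower_frame_bound(1)[OF assms(3)] .
  have X: "distributed M lborel (\<lambda>x. \<phi> \<omega> \<bullet> \<epsilon> x) (normal_density 0 \<sigma>)" for \<omega>
    by (rule distributed_inner_normal[OF assms(1) assms(4) assms(6) assms(7)])
  have [measurable]: "(\<lambda>x. \<phi> \<omega> \<bullet> \<epsilon> x) \<in> borel_measurable M" for \<omega>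
    using distributed_measurable[OF X[of \<omega>]] by simp
  have int: "integrable M (?risk \<omega>)" for \<omega>
    using soft_threshold_risk_le(1)[OF X assms(1)] assms(11) by simp
  have err_le: "?err x \<le> (\<Sum>\<omega>\<in>UNIV. ?risk \<omega> x) / ?a" for x
    using soft_threshold_estimator_error_le[OF assms(3), of u T "u + \<epsilon> x"]
    by (simp add: inner_add_right)
  \<comment> \<open>Measurability becomes evident once the estimator is a finite combination of
    fixed vectors with measurable real coefficients.\<close>
  have expand: "soft_threshold_estimator \<phi> T (u + \<epsilon> x)
      = (\<Sum>\<omega>\<in>UNIV. soft T (\<phi> \<omega> \<bullet> u + \<phi> \<omega> \<bullet> \<epsilon> x) *\<^sub>R ?P (axis \<omega> 1))" for x
  proof -
    note P = linear_pseudoinverse[OF linear_analysis_operator inj_analysis_operator[OF assms(3)]]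
    have *: "?P y = (\<Sum>\<omega>\<in>UNIV. y $ \<omega> *\<^sub>R ?P (axis \<omega> 1))" for y
      by (subst basis_expansion[of y, symmetric])
         (simp add: linear_sum[OF P] linear_scale[OF P] scalar_mult_eq_scaleR)
    show ?thesis
      unfolding soft_threshold_estimator_def
      by (subst *) (simp add: soft_threshold_def analysis_operator_def inner_add_right)
  qed
  have meas: "?err \<in> borel_measurable M"
    unfolding expand by measurable
  \<comment> \<open>The Bochner integral of a nonintegrable function is \<open>0\<close>, so the
    risk bound has its intended meaning only together with integrability. Domination by the scaled
    sum of coefficient risks provides it.\<close>
  have integrable: "integrable M ?err"
  proof (rule Bochner_Integration.integrable_bound[OF _ meas])
    show "integrable M (\<lambda>x. (\<Sum>\<omega>\<in>UNIV. ?risk \<omega> x) / ?a)" using int by simp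
    show "AE x in M. norm (?err x) \<le> norm ((\<Sum>\<omega>\<in>UNIV. ?risk \<omega> x) / ?a)"
      unfolding real_norm_def
      by (intro AE_I2 order_trans[OF _ abs_ge_self]) (simp only: abs_power2 err_le)
  qed
  \<comment> \<open>The assumed upper bound on \<open>T\<close> turns the large-mean risk
    \<open>\<sigma>\<^sup>2 + T\<^sup>2\<close> into the logarithmic factor
    \<open>1 + 2 * L\<close>.\<close>
  have "T\<^sup>2 \<le> (\<sigma> * sqrt (2 * L))\<^sup>2"
    using assms(11,12) unfolding L_def by (intro power_mono) auto
  also have "\<dots> = \<sigma>\<^sup>2 * (2 * L)"
    using assms(2) by (simp add: power_mult_distrib L_def)
  finally have T: "\<sigma>\<^sup>2 + T\<^sup>2 \<le> \<sigma>\<^sup>2 * (1 + 2 * L)"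
    by (simp add: algebra_simps)
  have "expectation ?err \<le> expectation (\<lambda>x. (\<Sum>\<omega>\<in>UNIV. ?risk \<omega> x) / ?a)"
    using int by (intro integral_mono integrable err_le) simp
  also have "\<dots> = (\<Sum>\<omega>\<in>UNIV. expectation (?risk \<omega>)) / ?a"
    using int by simp
  also have "\<dots> \<le> (\<Sum>\<omega>\<in>UNIV. \<sigma>\<^sup>2 * exp (- T\<^sup>2 / (2 * \<sigma>\<^sup>2))
      + \<sigma>\<^sup>2 * (1 + 2 * L) * min 1 (\<bar>\<phi> \<omega> \<bullet> u\<bar>\<^sup>2 / \<sigma>\<^sup>2)) / ?a"
  proof (intro divide_right_mono sum_mono)
    fix \<omega>
    have "expectation (?risk \<omega>)
        \<le> \<sigma>\<^sup>2 * exp (- T\<^sup>2 / (2 * \<sigma>\<^sup>2)) + (\<sigma>\<^sup>2 + T\<^sup>2) * min 1 (\<bar>\<phi> \<omega> \<bullet> u\<bar>\<^sup>2 / \<sigma>\<^sup>2)"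
      using soft_threshold_risk_le(2)[OF X assms(1)] assms(11) by simp
    also have "\<dots> \<le> \<sigma>\<^sup>2 * exp (- T\<^sup>2 / (2 * \<sigma>\<^sup>2))
        + \<sigma>\<^sup>2 * (1 + 2 * L) * min 1 (\<bar>\<phi> \<omega> \<bullet> u\<bar>\<^sup>2 / \<sigma>\<^sup>2)"
      by (intro add_left_mono mult_right_mono T) simp
    finally show "expectation (?risk \<omega>) \<le> \<dots>" .
  qed (use a in simp)
  also have "\<dots> = \<sigma>\<^sup>2 / ?a * (real CARD('w) * exp (- T\<^sup>2 / (2 * \<sigma>\<^sup>2))
      + (1 + 2 * L) * (\<Sum>\<omega>\<in>UNIV. min 1 (\<bar>\<phi> \<omega> \<bullet> u\<bar>\<^sup>2 / \<sigma>\<^sup>2)))"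
    by (simp add: sum.distrib sum_distrib_left[symmetric] add_divide_distrib algebra_simps)
  \<comment> \<open>The zero-mean risks, one per frame element, add up to the quantity that the
    threshold calibrates.\<close>
  also have "\<dots> \<le> \<sigma>\<^sup>2 / ?a * (ln (1 / (1 - \<alpha>)) * sqrt (pi * L)
      + (1 + 2 * L) * (\<Sum>\<omega>\<in>UNIV. min 1 (\<bar>\<phi> \<omega> \<bullet> u\<bar>\<^sup>2 / \<sigma>\<^sup>2)))"
    using exp_extreme_value_threshold_le[OF assms(1,2,8,9)] a
    by (intro mult_left_mono add_right_mono) (simp_all add: assms(10) L_def)
  finally show ?thesis using integrable by (simp add: L_def)
qed

end
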